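(* Let $A=A^{1,\dots,k}$ be a multipartition matrix with $k$ partitions that satisfies the generalized running intersection property (GRIP). Then the iterative proportional scaling (IPS) algorithm applied to $A$ results in the MLE after one cycle; that is, for every normalized data vector $d$, the vector $p^{k}$ produced after the first $k$ steps of IPS equals the maximum likelihood estimate $p^*(d)$ of $d$ in the model $\mathcal{M}_A$.
   Context: Write $[r]=\{1,\dots,r\}$. A partition matrix with $m$ columns is a $0/1$ matrix each of whose columns has exactly one entry equal to $1$; it is assumed to have no zero rows. A multipartition matrix $A=A^{1,\dots,k}$ with $k$ partitions is the matrix obtained by stacking partition matrices $A^1,\dots,A^k$, all with $m$ columns (the ordered list $A^1,\dots,A^k$ is part of the data). Let $n_\ell$ be the number of rows of $A^\ell$, $a^\ell_i$ the $i$-th row of $A^\ell$, $I^\ell_i\subset[m]$ its support, and $\mathcal{S}(\ell,j)\in[n_\ell]$ the unique index with $j\in I^\ell_{\mathcal{S}(\ell,j)}$. $A^{1,\dots,\ell}$ denotes the stacking of the first $\ell$ partitions, and $c^\ell_j$ the number of columns of $A^{1,\dots,\ell}$ equal to its $j$-th column (the $j$-th included). Well-connected: $A$ is well-connected if for every row $a^\ell_u$ with $\ell>1$ one has $c^\ell_j/c^{\ell-1}_j=c^\ell_{j'}/c^{\ell-1}_{j'}$ for all $j,j'\in I^\ell_u$. The matrix $\Cup_{n=1}^{\ell}A^n$: let $\beta$ be the number of distinct columns of $A^{1,\dots,\ell}$ and $\lambda:[m]\to[\beta]$ a surjective labeling with $\lambda(j)=\lambda(j')$ iff the $j$-th and $j'$-th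 columns of $A^{1,\dots,\ell}$ are equal. Then $\Cup_{n=1}^{\ell}A^n$ is the $\beta\times m$ partition matrix whose $j$-th column is the standard basis vector $e_{\lambda(j)}$ (well defined up to permuting rows). Florets: let $B,C$ be partition matrices with $m$ columns; $BC$ denotes $B$ stacked above $C$ (a multipartition matrix with two partitions). A row of $B$ and a row of $C$ are connected if their supports intersect. $B$ and $C$ (or $BC$) satisfy the floret condition if for any two rows of $B$, the sets of rows of $C$ connected to them are disjoint or equal. In that case the set of rows of $C$ connected to a given row of $B$ is called a floret of $C$; let $\mathcal{F}^C_1,\dots,\mathcal{F}^C_f$ be the distinct florets of $C$ (they partition the rows of $C$). Then $B\Cap C$ is the $f\times m$ matrix whose $(t,j)$ entry is $1$ if the row of $C$ having $j$ in its support lies in $\mathcal{F}^C_t$, and $0$ otherwise. GRIP: with $B_\ell=\Cup_{n=1}^{\ell}A^n$, the matrix $A^{1,\dots,k}$ satisfies the GRIP if for each $\ell\in[k-1]$: (1) $B_\ell A^{\ell+1}$ is well-connected; (2) $B_\ell A^{\ell+1}$ satisfies the floret condition; (3) the rows of $B_\ell\Cap A^{\ell+1}$ lie in the (real) rowspan of $A^{1,\dots,\ell}$. Model and MLE: $\Delta_{m-1}$ is the open probability simplex in $\mathbb{R}^m$ and $\mathcal{M}_A=\{p\in\Delta_{m-1}: \log p\in\mathrm{rowspan}(A)\}$ (coordinatewise log). A normalized data vector is $d\in\Delta_{m-1}$ (strictly positive entries summing to $1$). The maximum likelihood estimate $p^*(d)$ is the maximizer of $\prod_j p_j^{d_j}$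 over $p\in\mathcal{M}_A$. For a row $a$, $a(d)=\sum_j a_jd_j$. IPS: start with $p^0=(1/m,\dots,1/m)$. For $\ell\ge 1$ let $i\in[k]$ with $i\equiv \ell \pmod k$, and set $p^\ell_j=p^{\ell-1}_j\cdot \dfrac{a^i_{\mathcal{S}(i,j)}(d)}{a^i_{\mathcal{S}(i,j)}(p^{\ell-1})}$ for each $j\in[m]$. One cycle consists of the first $k$ steps. *)

theory Defs
  imports "HOL.Transcendental" "Jordan_Normal_Form.VS_Connect"
begin

text \<open>
  Rows, columns and partitions are numbered from 0: the entry \<open>As ! l\<close> of a list of partition
  matrices is the partition \<open>A^(l+1)\<close> of the usual 1-based numbering, and \<open>take l As\<close> consists
  of the first \<open>l\<close> partitions.
\<close>

section \<open>Multipartition matrices\<close>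

definition supp :: "real mat \<Rightarrow> nat \<Rightarrow> nat set" where
  "supp M i = {j. j < dim_col M \<and> M $$ (i, j) \<noteq> 0}"

definition partition_matrix :: "nat \<Rightarrow> real mat \<Rightarrow> bool" where
  "partition_matrix m M \<longleftrightarrow>
     dim_col M = m \<and>
     (\<forall>i<dim_row M. \<forall>j<m. M $$ (i, j) \<in> {0, 1}) \<and>
     (\<forall>j<m. \<exists>!i. i < dim_row M \<and> M $$ (i, j) = 1) \<and>
     (\<forall>i<dim_row M. row M i \<noteq> 0\<^sub>v m)"

definition multipartition :: "nat \<Rightarrow> real mat list \<Rightarrow> bool" where
  "multipartition m As \<longleftrightarrow> As \<noteq> [] \<and> (\<forall>M \<in> set As. partition_matrix m M)"

definition stack :: "nat \<Rightarrow> real mat list \<Rightarrow> real mat" where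
  "stack m As = mat_of_rows m (concat (map rows As))"

definition rowspan :: "real mat \<Rightarrow> real vec set" where
  "rowspan M = vec_space.row_space (dim_col M) M"

text \<open>The row of a partition matrix having \<open>j\<close> in its support.\<close>

definition row_containing :: "real mat \<Rightarrow> nat \<Rightarrow> nat" where
  "row_containing M j = (THE i. i < dim_row M \<and> j \<in> supp M i)"

section \<open>The generalized running intersection property\<close>

definition column_count :: "nat \<Rightarrow> real mat list \<Rightarrow> nat \<Rightarrow> nat \<Rightarrow> nat" where
  "column_count m As l j =
     card {j'. j' < m \<and> col (stack m (take l As)) j' = col (stack m (take l As)) j}"

text \<open>
  The index \<open>l\<close> below ranges over the partitions other than the first one; the partitions up to and
  including \<open>As ! l\<close> are \<open>take (Suc l) As\<close>.
\<close>

definition well_connected :: "nat \<Rightarrow> real mat list \<Rightarrow> bool" where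
  "well_connected m As \<longleftrightarrow>
     (\<forall>l u. 1 \<le> l \<and> l < length As \<and> u < dim_row (As ! l) \<longrightarrow>
        (\<forall>j \<in> supp (As ! l) u. \<forall>j' \<in> supp (As ! l) u.
           real (column_count m As (Suc l) j) / real (column_count m As l j) =
           real (column_count m As (Suc l) j') / real (column_count m As l j')))"

text \<open>
  Among the labelings of the distinct columns of \<open>M\<close> we fix the one by position in
  \<open>remdups (cols M)\<close>. Another choice only permutes the rows of \<open>Cup_matrix M\<close>, which affects none
  of the conditions below.
\<close>

definition column_label :: "real mat \<Rightarrow> nat \<Rightarrow> nat" where
  "column_label M j =
     (THE i. i < length (remdups (cols M)) \<and> remdups (cols M) ! i = col M j)"

definition Cup_matrix :: "real mat \<Rightarrow> real mat" where
  "Cup_matrix M =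
     mat (card (set (cols M))) (dim_col M) (\<lambda>(i, j). if i = column_label M j then 1 else 0)"

definition connected_rows :: "real mat \<Rightarrow> real mat \<Rightarrow> nat \<Rightarrow> nat set" where
  "connected_rows B C i = {u. u < dim_row C \<and> supp B i \<inter> supp C u \<noteq> {}}"

definition floret_condition :: "real mat \<Rightarrow> real mat \<Rightarrow> bool" where
  "floret_condition B C \<longleftrightarrow>
     (\<forall>i<dim_row B. \<forall>i'<dim_row B.
        connected_rows B C i \<inter> connected_rows B C i' = {} \<or>
        connected_rows B C i = connected_rows B C i')"

text \<open>The distinct florets of \<open>C\<close>, as sets of row indices; their order is immaterial.\<close>

definition florets :: "real mat \<Rightarrow> real mat \<Rightarrow> nat set list" where
  "florets B C = remdups (map (connected_rows B C) [0..<dim_row B])"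

definition Cap_matrix :: "real mat \<Rightarrow> real mat \<Rightarrow> real mat" where
  "Cap_matrix B C =
     mat (length (florets B C)) (dim_col C)
       (\<lambda>(t, j). if row_containing C j \<in> florets B C ! t then 1 else 0)"

definition GRIP :: "nat \<Rightarrow> real mat list \<Rightarrow> bool" where
  "GRIP m As \<longleftrightarrow>
     (\<forall>l. 1 \<le> l \<and> l < length As \<longrightarrow>
        (let B = Cup_matrix (stack m (take l As)); C = As ! l in
           well_connected m [B, C] \<and>
           floret_condition B C \<and>
           set (rows (Cap_matrix B C)) \<subseteq> rowspan (stack m (take l As))))"

section \<open>The model, maximum likelihood and iterative proportional scaling\<close>

definition open_simplex :: "nat \<Rightarrow> real vec set" where
  "open_simplex m = {p \<in> carrier_vec m. (\<forall>j<m. 0 < p $ j) \<and> (\<Sum>j<m. p $ j) = 1}"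

definition model :: "real mat \<Rightarrow> real vec set" where
  "model M = {p \<in> open_simplex (dim_col M). map_vec ln p \<in> rowspan M}"

definition likelihood :: "real vec \<Rightarrow> real vec \<Rightarrow> real" where
  "likelihood d p = (\<Prod>j<dim_vec d. p $ j powr d $ j)"

definition is_MLE :: "real mat \<Rightarrow> real vec \<Rightarrow> real vec \<Rightarrow> bool" where
  "is_MLE M d p \<longleftrightarrow> is_arg_max (likelihood d) (\<lambda>q. q \<in> model M) p"

primrec IPS :: "nat \<Rightarrow> real mat list \<Rightarrow> real vec \<Rightarrow> nat \<Rightarrow> real vec" where
  "IPS m As d 0 = vec m (\<lambda>_. 1 / real m)"
| "IPS m As d (Suc l) =
     (let M = As ! (l mod length As); p = IPS m As d l in
        vec m (\<lambda>j. p $ j * ((row M (row_containing M j) \<bullet> d) / (row M (row_containing M j) \<bullet> p))))"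

end

theory Submission
  imports Defs
begin

text \<open>
  The IPS vector \<open>p\<close> after \<open>l\<close> steps is constant on the classes of equal columns of the first \<open>l\<close>
  partitions, the rows of \<open>B\<close>. Well-connectedness says that a row \<open>u\<close> of the next partition \<open>C\<close> takes
  the same proportion \<open>r\<^sub>u\<close> of every class it meets, and by the floret condition these classes make up
  exactly one row \<open>F\<close> of the Cap matrix. Hence \<open>u(p) = r\<^sub>u F(p)\<close>, and \<open>F(p) = F(d)\<close> because \<open>F\<close> lies in the span
  of the rows already matched. Scaling by \<open>u(d) / u(p) = u(d) / (r\<^sub>u F(d))\<close> therefore preserves the sum
  over each class, so each step keeps the marginals fitted before. After one cycle all marginals agree
  with those of \<open>d\<close>, the logarithm lies in the row span, and Gibbs' inequality identifies the vector
  as the unique MLE.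
\<close>

section \<open>Sums over the fibres of a labelling, and rescaling within classes\<close>

text \<open>Each fibre total is divided by the size of the fibre and occurs once for every element
  of it. The use is to replace a function by its class averages without changing its sum.\<close>

lemma sum_fibres:
  fixes f :: "'i \<Rightarrow> real"
  assumes "finite J"
  shows "(\<Sum>j\<in>J. (\<Sum>i | i \<in> J \<and> x i = x j. f i) / card {i \<in> J. x i = x j}) = sum f J"
proof -
  have "(\<Sum>j\<in>J. (\<Sum>i | i \<in> J \<and> x i = x j. f i) / card {i \<in> J. x i = x j})
      = (\<Sum>c\<in>x ` J. \<Sum>j | j \<in> J \<and> x j = c. (\<Sum>i | i \<in> J \<and> x i = x j. f i) / card {i \<in> J. x i = x j})"
    by (rule sum.image_gen[OF assms])
  also have "\<dots> = (\<Sum>c\<in>x ` J. \<Sum>i | i \<in> J \<and> x i = c. f i)"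
  proof (rule sum.cong[OF refl])
    fix c assume "c \<in> x ` J"
    then have "card {i \<in> J. x i = c} \<noteq> 0" using assms by auto
    then show "(\<Sum>j | j \<in> J \<and> x j = c. (\<Sum>i | i \<in> J \<and> x i = x j. f i) / card {i \<in> J. x i = x j})
        = (\<Sum>i | i \<in> J \<and> x i = c. f i)"
      by simp
  qed
  also have "\<dots> = sum f J"
    by (rule sum.image_gen[OF assms, symmetric])
  finally show ?thesis .
qed

text \<open>On each fibre the constant value of \<open>a\<close> factors out, leaving the fibre sums
  of \<open>p\<close> and \<open>q\<close>. This turns preserved class sums into preserved
  marginals.\<close>

lemma sum_eq_if_fibre_sums_eq:
  fixes p q a :: "'i \<Rightarrow> real"
  assumes "finite J"
    and "\<And>j. j \<in> J \<Longrightarrow> (\<Sum>i | i \<in> J \<and> x i = x j. p i) = (\<Sum>i | i \<in> J \<and> x i = x j. q i)"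
    and "\<And>i j. i \<in> J \<Longrightarrow> j \<in> J \<Longrightarrow> x i = x j \<Longrightarrow> a i = a j"
  shows "(\<Sum>j\<in>J. a j * p j) = (\<Sum>j\<in>J. a j * q j)"
proof -
  have "(\<Sum>i | i \<in> J \<and> x i = c. a i * p i) = (\<Sum>i | i \<in> J \<and> x i = c. a i * q i)" if c: "c \<in> x ` J" for c
  proof -
    obtain j where j: "j \<in> J" "c = x j" using c by blast
    have "(\<Sum>i | i \<in> J \<and> x i = c. a i * r i) = a j * (\<Sum>i | i \<in> J \<and> x i = c. r i)" for r
      unfolding sum_distrib_left
    proof (rule sum.cong[OF refl])
      fix i assume "i \<in> {i \<in> J. x i = c}"
      then have "a i = a j" using assms(3)[of i j] j by simp
      then show "a i * r i = a j * r i" by simp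
    qed
    then show ?thesis using assms(2) j by simp
  qed
  then show ?thesis
    by (subst (1 2) sum.image_gen[OF assms(1), of _ x]) (simp cong: sum.cong)
qed

text \<open>
  Here \<open>x\<close> labels the classes of equal columns, \<open>y\<close> the rows of the next partition, and \<open>F j\<close> is the
  floret of the class of \<open>j\<close>.
\<close>

lemma class_sum_scaling:
  fixes J :: "'i set" and p d :: "'i \<Rightarrow> real" and x :: "'i \<Rightarrow> 'x" and y :: "'i \<Rightarrow> 'y"
  defines "F \<equiv> \<lambda>j. y ` {i \<in> J. x i = x j}"
  assumes fin: "finite J"
    and pos: "\<And>j. j \<in> J \<Longrightarrow> 0 < p j"
    and const: "\<And>i j. i \<in> J \<Longrightarrow> j \<in> J \<Longrightarrow> x i = x j \<Longrightarrow> p i = p j"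
    and wc: "\<And>i j. i \<in> J \<Longrightarrow> j \<in> J \<Longrightarrow> y i = y j \<Longrightarrow>
       real (card {k \<in> J. x k = x i \<and> y k = y i}) / real (card {k \<in> J. x k = x i}) =
       real (card {k \<in> J. x k = x j \<and> y k = y j}) / real (card {k \<in> J. x k = x j})"
    and floret: "\<And>i j. i \<in> J \<Longrightarrow> j \<in> J \<Longrightarrow> F i \<inter> F j = {} \<or> F i = F j"
    and marg: "\<And>j. j \<in> J \<Longrightarrow> (\<Sum>i | i \<in> J \<and> y i \<in> F j. p i) = (\<Sum>i | i \<in> J \<and> y i \<in> F j. d i)"
    and j0: "j0 \<in> J"
  shows "(\<Sum>j | j \<in> J \<and> x j = x j0.
            p j * ((\<Sum>i | i \<in> J \<and> y i = y j. d i) / (\<Sum>i | i \<in> J \<and> y i = y j. p i)))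
       = (\<Sum>j | j \<in> J \<and> x j = x j0. p j)"
proof -
  define N where "N = (\<lambda>j. card {k \<in> J. x k = x j})"
  define Nxy where "Nxy = (\<lambda>j. card {k \<in> J. x k = x j \<and> y k = y j})"
  \<comment> \<open>\<open>T\<close> is the support of the Cap row that belongs to the floret of
    \<open>j0\<close>.\<close>
  define T where "T = {i \<in> J. y i \<in> F j0}"
  have finT: "finite T" using fin by (simp add: T_def)
  have Nxy0: "Nxy j \<noteq> 0" if "j \<in> J" for j
    using that fin by (auto simp: Nxy_def)
  have wc': "real (Nxy i) / N i = real (Nxy j) / N j" if "i \<in> J" "j \<in> J" "y i = y j" for i j
    using wc[OF that] by (simp add: N_def Nxy_def)
  have y_in_F: "y j \<in> F j" if "j \<in> J" for j
    using that by (auto simp: F_def)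
  \<comment> \<open>For \<open>i\<close> in \<open>T\<close> the label \<open>y i\<close> lies in
    both florets, so the floret condition makes them equal. Together with \<open>F_cong\<close> this
    shows that \<open>T\<close> is a union of whole classes.\<close>
  have T_iff: "i \<in> T \<longleftrightarrow> i \<in> J \<and> F i = F j0" for i
    using floret[of i j0] y_in_F[of i] j0 by (auto simp: T_def)
  have F_cong: "F i = F j" if "x i = x j" for i j
    using that by (simp add: F_def)
  have j0T: "j0 \<in> T" using j0 T_iff by blast
  \<comment> \<open>This is the identity u(p) = r F(p) for the row u of \<open>j\<close>, with
    proportion r = \<open>Nxy j / N j\<close>.\<close>
  have den: "(\<Sum>i | i \<in> J \<and> y i = y j. p i) = Nxy j / N j * sum p T" if j: "j \<in> J" "x j = x j0" for j
  proof -
    have "y j \<in> F j0" using y_in_F[OF j(1)] F_cong[OF j(2)] by simp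
    then have yT: "{i \<in> J. y i = y j} \<subseteq> T" by (auto simp: T_def)
    \<comment> \<open>The averaging lemma is applied to \<open>p\<close> cut off outside the row of
      \<open>j\<close>: on a class in \<open>T\<close> the average of this function is the constant
      value of \<open>p\<close> times the proportion of the class lying in that row.\<close>
    have "Nxy j / N j * sum p T = (\<Sum>i\<in>T. (\<Sum>k | k \<in> T \<and> x k = x i. if y k = y j then p k else 0)
                                     / card {k \<in> T. x k = x i})"
      unfolding sum_distrib_left
    proof (rule sum.cong[OF refl])
      fix i assume i: "i \<in> T"
      then have "F i = F j0" using T_iff by blast
      then have "y j \<in> F i" using \<open>y j \<in> F j0\<close> by simp
      \<comment> \<open>Since the florets agree, the class of \<open>i\<close> really meets the row
        of \<open>j\<close>. The common column \<open>k\<close> allows well-connectedness to compare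
        the proportions in the two classes.\<close>
      then obtain k where k: "k \<in> J" "x k = x i" "y k = y j" by (auto simp: F_def)
      have iJ: "i \<in> J" using i T_iff by blast
      have "l \<in> T" if "l \<in> J" "x l = x i" for l
        using F_cong[OF that(2)] that(1) \<open>F i = F j0\<close> T_iff by simp
      then have fib: "{k \<in> T. x k = x i} = {k \<in> J. x k = x i}"
        using T_iff by blast
      have "(\<Sum>l | l \<in> T \<and> x l = x i. if y l = y j then p l else 0)
          = (\<Sum>l | l \<in> J \<and> x l = x k \<and> y l = y k. p l)"
        unfolding fib using fin k by (simp add: sum.If_cases Int_def conj_ac)
      also have "\<dots> = (\<Sum>l | l \<in> J \<and> x l = x k \<and> y l = y k. p i)"
        by (intro sum.cong refl const) (use iJ k in auto)
      also have "\<dots> = Nxy k * p i" by (simp add: Nxy_def)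
      finally show "Nxy j / N j * p i = (\<Sum>l | l \<in> T \<and> x l = x i. if y l = y j then p l else 0)
                                     / card {k \<in> T. x k = x i}"
        using wc'[OF k(1) j(1) k(3)] k fib by (simp add: N_def flip: times_divide_eq_left)
    qed
    also have "\<dots> = (\<Sum>k\<in>T. if y k = y j then p k else 0)" by (rule sum_fibres[OF finT])
    also have "\<dots> = (\<Sum>i | i \<in> J \<and> y i = y j. p i)"
      using finT yT by (auto simp: sum.If_cases T_def intro!: sum.cong)
    finally show ?thesis by simp
  qed
  have posT: "0 < sum p T"
    using finT j0T T_iff pos by (intro sum_pos) auto
  have margT: "sum d T = sum p T" using marg[OF j0] by (simp add: T_def)
  let ?X = "{j \<in> J. x j = x j0}"
  \<comment> \<open>After \<open>den\<close> is inserted, \<open>p j\<close> and \<open>N j\<close>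
    are constant on the class of \<open>j0\<close>; besides the row sum of \<open>d\<close>, only
    \<open>Nxy j\<close> still varies.\<close>
  have "(\<Sum>j\<in>?X. p j * ((\<Sum>i | i \<in> J \<and> y i = y j. d i) / (\<Sum>i | i \<in> J \<and> y i = y j. p i)))
      = (\<Sum>j\<in>?X. p j0 * N j0 / sum p T * ((\<Sum>i | i \<in> J \<and> y i = y j. d i) / Nxy j))"
  proof (rule sum.cong[OF refl])
    fix j assume j: "j \<in> ?X"
    then have "N j = N j0" "p j = p j0" using const[of j j0] j0 by (auto simp: N_def)
    then show "p j * ((\<Sum>i | i \<in> J \<and> y i = y j. d i) / (\<Sum>i | i \<in> J \<and> y i = y j. p i))
       = p j0 * N j0 / sum p T * ((\<Sum>i | i \<in> J \<and> y i = y j. d i) / Nxy j)"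
      using j den[of j] by (simp add: mult_ac)
  qed
  also have "\<dots> = p j0 * N j0 / sum p T * (\<Sum>j\<in>?X. (\<Sum>i | i \<in> J \<and> y i = y j. d i) / Nxy j)"
    by (simp add: sum_distrib_left)
  \<comment> \<open>The class is sorted by rows. A row \<open>c\<close> meets it in exactly
    \<open>Nxy k\<close> columns, for any \<open>k\<close> among them, so the division cancels and
    the sum of \<open>d\<close> over row \<open>c\<close> remains.\<close>
  also have "(\<Sum>j\<in>?X. (\<Sum>i | i \<in> J \<and> y i = y j. d i) / Nxy j)
      = (\<Sum>c\<in>y ` ?X. \<Sum>j | j \<in> ?X \<and> y j = c. (\<Sum>i | i \<in> J \<and> y i = y j. d i) / Nxy j)"
    using fin by (intro sum.image_gen) auto
  also have "\<dots> = (\<Sum>c\<in>y ` ?X. \<Sum>i | i \<in> T \<and> y i = c. d i)"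
  proof (rule sum.cong[OF refl])
    fix c assume c: "c \<in> y ` ?X"
    then obtain k where k: "k \<in> ?X" "y k = c" by blast
    have "(\<Sum>j | j \<in> ?X \<and> y j = c. (\<Sum>i | i \<in> J \<and> y i = y j. d i) / Nxy j)
        = (\<Sum>j | j \<in> ?X \<and> y j = c. (\<Sum>i | i \<in> J \<and> y i = c. d i) / Nxy k)"
      using k by (intro sum.cong) (auto simp: Nxy_def)
    also have "\<dots> = (\<Sum>i | i \<in> J \<and> y i = c. d i)"
      using k Nxy0[of k] by (simp add: Nxy_def conj_assoc)
    also have "\<dots> = (\<Sum>i | i \<in> T \<and> y i = c. d i)"
      using c by (intro sum.cong) (auto simp: T_def F_def)
    finally show "(\<Sum>j | j \<in> ?X \<and> y j = c. (\<Sum>i | i \<in> J \<and> y i = y j. d i) / Nxy j)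
      = (\<Sum>i | i \<in> T \<and> y i = c. d i)" .
  qed
  \<comment> \<open>By the choice of \<open>T\<close>, its columns have exactly the labels that
    occur in the class of \<open>j0\<close>, so the row sums reassemble to the sum over
    \<open>T\<close>.\<close>
  also have "\<dots> = sum d T"
    using finT fin by (intro sum.group) (auto simp: T_def F_def)
  also have "p j0 * N j0 / sum p T * sum d T = (\<Sum>j\<in>?X. p j0)"
    using margT posT by (simp add: N_def)
  also have "\<dots> = sum p ?X"
    by (intro sum.cong refl const) (use j0 in auto)
  finally show ?thesis by simp
qed

section \<open>Gibbs' inequality\<close>

text \<open>Apply ln t \<le> t - 1 to t = \<open>q j / p j\<close> and sum with weights
  \<open>p j\<close>; the linear bounds add up to zero because the totals agree. Equality in the
  bound forces t = 1, so the index \<open>k\<close> makes the inequality strict.\<close>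

lemma sum_mult_ln_less:
  fixes p q :: "'i \<Rightarrow> real"
  assumes "finite J" "\<And>j. j \<in> J \<Longrightarrow> 0 < p j" "\<And>j. j \<in> J \<Longrightarrow> 0 < q j"
    and "sum p J = sum q J" "k \<in> J" "p k \<noteq> q k"
  shows "(\<Sum>j\<in>J. p j * ln (q j)) < (\<Sum>j\<in>J. p j * ln (p j))"
proof -
  have *: "p j * ln (q j) - p j * ln (p j) = p j * ln (q j / p j)" if "j \<in> J" for j
    using assms(2,3)[OF that] by (simp add: ln_div right_diff_distrib)
  have le: "p j * ln (q j) - p j * ln (p j) \<le> q j - p j" if "j \<in> J" for j
  proof -
    have "p j * ln (q j / p j) \<le> p j * (q j / p j - 1)"
      using assms(2,3)[OF that] by (intro mult_left_mono ln_le_minus_one) auto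
    then show ?thesis using assms(2)[OF that] *[OF that] by (simp add: right_diff_distrib)
  qed
  have lt: "p k * ln (q k) - p k * ln (p k) < q k - p k"
  proof -
    have "ln (q k / p k) \<noteq> q k / p k - 1"
      using ln_eq_minus_one[of "q k / p k"] assms(2,3,5,6) by force
    moreover have "ln (q k / p k) \<le> q k / p k - 1"
      using assms(2,3,5) by (intro ln_le_minus_one) auto
    ultimately have "p k * ln (q k / p k) < p k * (q k / p k - 1)"
      using assms(2,5) by (intro mult_strict_left_mono) auto
    then show ?thesis using assms(2)[OF assms(5)] *[OF assms(5)] by (simp add: right_diff_distrib)
  qed
  have "(\<Sum>j\<in>J. p j * ln (q j) - p j * ln (p j)) < (\<Sum>j\<in>J. q j - p j)"
    using assms(1,5) le lt by (intro sum_strict_mono_ex1) auto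
  then show ?thesis using assms(4) by (simp add: sum_subtractf)
qed

section \<open>Partition matrices as labellings of the columns\<close>

lemma scalar_prod_lessThan: "w \<in> carrier_vec m \<Longrightarrow> v \<bullet> w = (\<Sum>j<m. v $ j * w $ j)"
  by (simp add: scalar_prod_def lessThan_atLeast0)

lemma partition_matrix_dim_col: "partition_matrix m M \<Longrightarrow> dim_col M = m"
  by (simp add: partition_matrix_def)

text \<open>Uniqueness of the entry 1 in a column makes the definite description in
  \<open>row_containing\<close> meaningful. From here on a partition is handled mostly through the
  map \<open>row_containing M\<close>.\<close>

lemma row_containing_partition:
  assumes "partition_matrix m M" "j < m"
  shows row_containing_less: "row_containing M j < dim_row M"
    and partition_matrix_index:
      "\<And>i. i < dim_row M \<Longrightarrow> M $$ (i, j) = (if i = row_containing M j then 1 else 0)"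
proof -
  have vals: "\<forall>i<dim_row M. \<forall>j<m. M $$ (i, j) \<in> {0, 1}"
    by (rule assms(1)[unfolded partition_matrix_def, THEN conjunct2, THEN conjunct1])
  have unique: "\<forall>j<m. \<exists>!i. i < dim_row M \<and> M $$ (i, j) = 1"
    by (rule assms(1)[unfolded partition_matrix_def, THEN conjunct2, THEN conjunct2, THEN conjunct1])
  have val: "M $$ (i, j) = 0 \<or> M $$ (i, j) = 1" if "i < dim_row M" for i
    using vals that assms(2) by simp
  have supp_iff: "i < dim_row M \<and> j \<in> supp M i \<longleftrightarrow> i < dim_row M \<and> M $$ (i, j) = 1" for i
    using assms(2) val[of i] partition_matrix_dim_col[OF assms(1)] by (auto simp: supp_def)
  have rc: "row_containing M j = (THE i. i < dim_row M \<and> M $$ (i, j) = 1)"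
    by (simp only: row_containing_def supp_iff)
  have ex1: "\<exists>!i. i < dim_row M \<and> M $$ (i, j) = 1"
    using unique assms(2) by simp
  note r = theI'[OF ex1, folded rc]
  show "row_containing M j < dim_row M" using r ..
  show "M $$ (i, j) = (if i = row_containing M j then 1 else 0)" if "i < dim_row M" for i
  proof (cases "i = row_containing M j")
    case False
    then have "M $$ (i, j) \<noteq> 1" using ex1 r that by blast
    then show ?thesis using val[OF that] False by simp
  qed (use r in simp)
qed

lemma supp_partition_matrix:
  assumes "partition_matrix m M" "i < dim_row M"
  shows "supp M i = {j. j < m \<and> row_containing M j = i}"
proof -
  have "dim_col M = m" by (rule partition_matrix_dim_col[OF assms(1)])
  then show ?thesis
    using partition_matrix_index[OF assms(1) _ assms(2)] by (auto simp: supp_def split: if_splits)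
qed

text \<open>Rests on the exclusion of zero rows: a row that labels no column would vanish.\<close>

lemma supp_partition_matrix_nonempty:
  assumes "partition_matrix m M" "i < dim_row M"
  shows "\<exists>j<m. row_containing M j = i"
proof (rule ccontr)
  assume none: "\<not> (\<exists>j<m. row_containing M j = i)"
  have "dim_col M = m" by (rule partition_matrix_dim_col[OF assms(1)])
  then have "row M i = 0\<^sub>v m"
    using none partition_matrix_index[OF assms(1) _ assms(2)] assms(2) by (intro eq_vecI) auto
  then show False using assms by (simp add: partition_matrix_def)
qed

lemma row_partition_scalar_prod:
  assumes "partition_matrix m M" "i < dim_row M" "v \<in> carrier_vec m"
  shows "row M i \<bullet> v = (\<Sum>j | j < m \<and> row_containing M j = i. v $ j)"
proof -
  have dim: "dim_col M = m" by (rule partition_matrix_dim_col[OF assms(1)])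
  have "row M i \<bullet> v = (\<Sum>j<m. if row_containing M j = i then v $ j else 0)"
    unfolding scalar_prod_lessThan[OF assms(3)]
    using assms(2) dim partition_matrix_index[OF assms(1) _ assms(2)]
    by (intro sum.cong) simp_all
  also have "\<dots> = (\<Sum>j | j < m \<and> row_containing M j = i. v $ j)"
    by (simp add: sum.If_cases Int_def)
  finally show ?thesis .
qed

lemma dim_col_stack [simp]: "dim_col (stack m Ms) = m"
  by (simp add: stack_def)

lemma set_rows_stack:
  assumes "\<forall>M\<in>set Ms. partition_matrix m M"
  shows "set (rows (stack m Ms)) = (\<Union>M\<in>set Ms. set (rows M))"
proof -
  have "set (concat (map rows Ms)) \<subseteq> carrier_vec m"
    using assms by (auto simp: partition_matrix_def rows_def)
  then show ?thesis by (simp add: stack_def)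
qed

lemma set_rows: "set (rows M) = row M ` {..<dim_row M}"
  by (auto simp: rows_def)

text \<open>Within each partition a column is a unit vector determined by its label, so stacked
  columns can be compared label by label.\<close>

lemma col_stack_eq_iff:
  assumes parts: "\<forall>M\<in>set Ms. partition_matrix m M" and "i < m" "j < m"
  shows "col (stack m Ms) i = col (stack m Ms) j \<longleftrightarrow>
    (\<forall>M\<in>set Ms. row_containing M i = row_containing M j)"
proof -
  let ?rs = "concat (map rows Ms)"
  have col: "col (stack m Ms) k = vec (length ?rs) (\<lambda>l. ?rs ! l $ k)" if "k < m" for k
    using that by (intro eq_vecI) (simp_all add: stack_def mat_of_rows_def del: length_concat)
  have "col (stack m Ms) i = col (stack m Ms) j \<longleftrightarrow> (\<forall>v\<in>set ?rs. v $ i = v $ j)"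
    unfolding col[OF assms(2)] col[OF assms(3)] all_set_conv_all_nth
    by (metis (no_types, lifting) eq_vecI dim_vec index_vec)
  also have "\<dots> \<longleftrightarrow> (\<forall>M\<in>set Ms. \<forall>k<dim_row M. M $$ (k, i) = M $$ (k, j))"
    using assms by (auto simp: set_rows partition_matrix_def)
  also have "\<dots> \<longleftrightarrow> (\<forall>M\<in>set Ms. row_containing M i = row_containing M j)"
  proof (rule ball_cong[OF refl])
    fix M assume "M \<in> set Ms"
    then have M: "partition_matrix m M" using parts by blast
    show "(\<forall>k<dim_row M. M $$ (k, i) = M $$ (k, j)) \<longleftrightarrow> row_containing M i = row_containing M j"
      using row_containing_less[OF M assms(2)] partition_matrix_index[OF M assms(2)]
        partition_matrix_index[OF M assms(3)]
      by (auto split: if_splits)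
  qed
  finally show ?thesis .
qed

lemma column_count_partitions:
  assumes "\<forall>M\<in>set Ms. partition_matrix m M" "j < m"
  shows "column_count m Ms l j =
    card {k \<in> {..<m}. \<forall>M\<in>set (take l Ms). row_containing M k = row_containing M j}"
proof -
  have "\<forall>M\<in>set (take l Ms). partition_matrix m M"
    using assms(1) by (auto dest: in_set_takeD)
  then show ?thesis
    using assms(2) unfolding column_count_def
    by (intro arg_cong[of _ _ card]) (auto simp: col_stack_eq_iff)
qed

section \<open>The Cup and Cap matrices and the conditions of the GRIP\<close>

text \<open>Since \<open>remdups\<close> keeps each column once, the position described by
  \<open>column_label\<close> exists and is unique.\<close>

lemma column_label_nth:
  assumes "j < dim_col M"
  shows "column_label M j < card (set (cols M))"
    and "remdups (cols M) ! column_label M j = col M j"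
proof -
  have "col M j \<in> set (remdups (cols M))"
    using assms by (simp add: cols_def)
  then have "\<exists>!i. i < length (remdups (cols M)) \<and> remdups (cols M) ! i = col M j"
    by (metis distinct_Ex1 distinct_remdups)
  from theI'[OF this] show "column_label M j < card (set (cols M))"
    and "remdups (cols M) ! column_label M j = col M j"
    by (simp_all add: column_label_def length_remdups_card_conv)
qed

lemma row_containing_Cup_matrix:
  assumes "j < dim_col M"
  shows "row_containing (Cup_matrix M) j = column_label M j"
  unfolding row_containing_def
  using assms column_label_nth(1)[OF assms]
  by (intro the_equality) (auto simp: supp_def Cup_matrix_def split: if_splits)

lemma partition_Cup_matrix: "partition_matrix (dim_col M) (Cup_matrix M)"
proof -
  have "row (Cup_matrix M) i \<noteq> 0\<^sub>v (dim_col M)" if i: "i < card (set (cols M))" for i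
  proof -
    have len: "i < length (remdups (cols M))"
      using i by (simp add: length_remdups_card_conv)
    then have "remdups (cols M) ! i \<in> set (cols M)"
      by (metis nth_mem set_remdups)
    \<comment> \<open>Every listed column occurs at some index \<open>j\<close>, and there the row
      of the Cup matrix has an entry 1.\<close>
    then obtain j where j: "j < dim_col M" "remdups (cols M) ! i = col M j"
      by (auto simp: cols_def)
    then have "i = column_label M j"
      using column_label_nth[OF j(1)] len
      by (metis distinct_remdups length_remdups_card_conv nth_eq_iff_index_eq)
    then have "row (Cup_matrix M) i $ j \<noteq> 0\<^sub>v (dim_col M) $ j"
      using i j(1) by (simp add: Cup_matrix_def)
    then show ?thesis by metis
  qed
  moreover have "\<exists>!i. i < dim_row (Cup_matrix M) \<and> Cup_matrix M $$ (i, j) = 1"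
    if j: "j < dim_col M" for j
    by (intro ex1I[of _ "column_label M j"])
      (use column_label_nth(1)[OF j] j in \<open>auto simp: Cup_matrix_def split: if_splits\<close>)
  ultimately show ?thesis
    unfolding partition_matrix_def by (simp add: Cup_matrix_def)
qed

lemma row_containing_Cup_matrix_eq_iff:
  assumes "i < dim_col M" "j < dim_col M"
  shows "row_containing (Cup_matrix M) i = row_containing (Cup_matrix M) j \<longleftrightarrow> col M i = col M j"
proof -
  have "column_label M i = column_label M j \<longleftrightarrow> col M i = col M j"
  proof
    assume "column_label M i = column_label M j"
    then show "col M i = col M j"
      using column_label_nth(2)[OF assms(1)] column_label_nth(2)[OF assms(2)] by metis
  qed (simp add: column_label_def)
  then show ?thesis using assms by (simp add: row_containing_Cup_matrix)
qed

text \<open>A row of \<open>C\<close> is connected exactly when some column of the given row of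
  \<open>B\<close> carries its label. This brings florets into the form \<open>F\<close> of
  \<open>class_sum_scaling\<close>.\<close>

lemma connected_rows_row_containing:
  assumes "partition_matrix m B" "partition_matrix m C" "j < m"
  shows "connected_rows B C (row_containing B j) =
    row_containing C ` {i \<in> {..<m}. row_containing B i = row_containing B j}"
proof -
  have "connected_rows B C (row_containing B j) = {u. u < dim_row C \<and>
      (\<exists>i<m. row_containing B i = row_containing B j \<and> row_containing C i = u)}"
    unfolding connected_rows_def supp_partition_matrix[OF assms(1) row_containing_less[OF assms(1,3)]]
    using supp_partition_matrix[OF assms(2)] by blast
  also have "\<dots> = row_containing C ` {i \<in> {..<m}. row_containing B i = row_containing B j}"
    using row_containing_less[OF assms(2)] by blast
  finally show ?thesis .
qed

text \<open>For the list \<open>[B, C]\<close>, \<open>column_count\<close> at level 1 is the size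
  of a row of \<open>B\<close>, and at level 2 the size of its intersection with a row of
  \<open>C\<close>.\<close>

lemma well_connected_pair_ratio:
  assumes B: "partition_matrix m B" and C: "partition_matrix m C" and "well_connected m [B, C]"
    and "i < m" "j < m" "row_containing C i = row_containing C j"
  shows "real (card {k \<in> {..<m}. row_containing B k = row_containing B i
              \<and> row_containing C k = row_containing C i})
        / real (card {k \<in> {..<m}. row_containing B k = row_containing B i})
      = real (card {k \<in> {..<m}. row_containing B k = row_containing B j
              \<and> row_containing C k = row_containing C j})
        / real (card {k \<in> {..<m}. row_containing B k = row_containing B j})"
proof -
  have u: "row_containing C j < dim_row C" by (rule row_containing_less[OF C assms(5)])
  have "i \<in> supp C (row_containing C j)" "j \<in> supp C (row_containing C j)"
    using assms(4-6) by (simp_all add: supp_partition_matrix[OF C u])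
  then have ratio: "real (column_count m [B, C] 2 i) / real (column_count m [B, C] 1 i) =
      real (column_count m [B, C] 2 j) / real (column_count m [B, C] 1 j)"
    using assms(3)[unfolded well_connected_def, rule_format, of 1 "row_containing C j" i j] u
    by (simp add: numeral_2_eq_2)
  have "column_count m [B, C] 1 k = card {h \<in> {..<m}. row_containing B h = row_containing B k}"
    and "column_count m [B, C] 2 k = card {h \<in> {..<m}. row_containing B h = row_containing B k
           \<and> row_containing C h = row_containing C k}" if "k < m" for k
    using column_count_partitions[of "[B, C]" m k 1] column_count_partitions[of "[B, C]" m k 2] B C that
    by simp_all
  note counts = this[OF assms(4)] this[OF assms(5)]
  show ?thesis using ratio unfolding counts .
qed

lemma floret_indicator_in_rows_Cap_matrix:
  assumes "i < dim_row B"
  shows "vec (dim_col C) (\<lambda>j. if row_containing C j \<in> connected_rows B C i then 1 else 0)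
    \<in> set (rows (Cap_matrix B C))"
proof -
  have "connected_rows B C i \<in> set (florets B C)"
    using assms by (auto simp: florets_def)
  then obtain t where t: "t < length (florets B C)" "florets B C ! t = connected_rows B C i"
    by (auto simp: in_set_conv_nth)
  then have "vec (dim_col C) (\<lambda>j. if row_containing C j \<in> connected_rows B C i then 1 else 0)
      = row (Cap_matrix B C) t"
    by (intro eq_vecI) (simp_all add: Cap_matrix_def)
  then show ?thesis
    using t(1) by (simp add: set_rows Cap_matrix_def)
qed

section \<open>The row span of a stack\<close>

text \<open>Gathers the facts that need the vector space locale. For the last one, the vectors
  having equal scalar products with \<open>p\<close> and \<open>q\<close> form a submodule, so
  agreement on the generating rows extends to their span.\<close>

lemma rowspan_stack:
  assumes "\<forall>M\<in>set Ms. partition_matrix m M"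
  shows rowspan_stack_row: "\<And>M i. M \<in> set Ms \<Longrightarrow> i < dim_row M \<Longrightarrow> row M i \<in> rowspan (stack m Ms)"
    and rowspan_stack_zero: "0\<^sub>v m \<in> rowspan (stack m Ms)"
    and rowspan_stack_add: "\<And>v w. v \<in> rowspan (stack m Ms) \<Longrightarrow> w \<in> rowspan (stack m Ms) \<Longrightarrow>
      v + w \<in> rowspan (stack m Ms)"
    and rowspan_stack_smult: "\<And>a v. v \<in> rowspan (stack m Ms) \<Longrightarrow> a \<cdot>\<^sub>v v \<in> rowspan (stack m Ms)"
    and rowspan_stack_scalar_prod_eq: "\<And>v p q. v \<in> rowspan (stack m Ms) \<Longrightarrow>
      p \<in> carrier_vec m \<Longrightarrow> q \<in> carrier_vec m \<Longrightarrow>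
      (\<And>M i. M \<in> set Ms \<Longrightarrow> i < dim_row M \<Longrightarrow> row M i \<bullet> p = row M i \<bullet> q) \<Longrightarrow> v \<bullet> p = v \<bullet> q"
proof -
  interpret vec_space "TYPE(real)" m .
  let ?R = "\<Union>M\<in>set Ms. set (rows M)"
  have R: "?R \<subseteq> carrier_vec m"
    using assms by (auto simp: partition_matrix_def rows_def)
  have span: "rowspan (stack m Ms) = span ?R"
    by (simp add: rowspan_def row_space_def set_rows_stack[OF assms])
  show "row M i \<in> rowspan (stack m Ms)" if "M \<in> set Ms" "i < dim_row M" for M i
    unfolding span using that R by (intro span_mem) (auto simp: set_rows)
  show "0\<^sub>v m \<in> rowspan (stack m Ms)"
    unfolding span using span_zero by simp
  show "v + w \<in> rowspan (stack m Ms)"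
    if "v \<in> rowspan (stack m Ms)" "w \<in> rowspan (stack m Ms)" for v w
    using that span_add1[of ?R v w] R unfolding span by simp
  show "a \<cdot>\<^sub>v v \<in> rowspan (stack m Ms)" if "v \<in> rowspan (stack m Ms)" for a v
    using that smult_in_span[of ?R v a] R unfolding span by simp
  show "v \<bullet> p = v \<bullet> q"
    if "v \<in> rowspan (stack m Ms)" "p \<in> carrier_vec m" "q \<in> carrier_vec m"
      and rows: "\<And>M i. M \<in> set Ms \<Longrightarrow> i < dim_row M \<Longrightarrow> row M i \<bullet> p = row M i \<bullet> q" for v p q
  proof -
    let ?N = "{v \<in> carrier_vec m. v \<bullet> p = v \<bullet> q}"
    have "submodule class_ring ?N V"
      using that(2,3)
      by unfold_locales
        (auto simp: add_scalar_prod_distrib[of _ m] smult_scalar_prod_distrib[of _ m])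
    moreover have "?R \<subseteq> ?N"
      using R rows by (auto simp: set_rows)
    ultimately have "span ?R \<subseteq> ?N" by (rule span_is_subset[rotated])
    then show ?thesis using that(1) span by blast
  qed
qed

text \<open>The vector is the combination of the rows of \<open>M\<close> with coefficients
  \<open>c\<close>. Cutting it off at label \<open>n\<close> lets an induction add one multiple
  \<open>c n\<close> of a row at a time.\<close>

lemma vec_row_containing_in_rowspan:
  assumes parts: "\<forall>M\<in>set Ms. partition_matrix m M" and "M \<in> set Ms"
  shows "vec m (\<lambda>j. c (row_containing M j)) \<in> rowspan (stack m Ms)"
proof -
  have M: "partition_matrix m M" using assms by blast
  have "vec m (\<lambda>j. if row_containing M j < n then c (row_containing M j) else 0)
      \<in> rowspan (stack m Ms)" if "n \<le> dim_row M" for n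
    using that
  proof (induction n)
    case 0
    then show ?case
      using rowspan_stack_zero[OF parts] by (simp add: zero_vec_def)
  next
    case (Suc n)
    then have n: "n < dim_row M" by simp
    have "vec m (\<lambda>j. if row_containing M j < Suc n then c (row_containing M j) else 0)
        = vec m (\<lambda>j. if row_containing M j < n then c (row_containing M j) else 0)
          + c n \<cdot>\<^sub>v row M n"
      using n partition_matrix_index[OF M _ n] partition_matrix_dim_col[OF M]
      by (intro eq_vecI) (simp_all add: less_Suc_eq)
    then show ?case
      using Suc rowspan_stack_add[OF parts] rowspan_stack_smult[OF parts]
        rowspan_stack_row[OF parts assms(2) n] by simp
  qed
  from this[of "dim_row M"] have
    "vec m (\<lambda>j. if row_containing M j < dim_row M then c (row_containing M j) else 0)
      \<in> rowspan (stack m Ms)" by simp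
  also have "vec m (\<lambda>j. if row_containing M j < dim_row M then c (row_containing M j) else 0)
      = vec m (\<lambda>j. c (row_containing M j))"
    using row_containing_less[OF M] by (intro eq_vecI) auto
  finally show ?thesis .
qed

section \<open>Maximum likelihood from matching marginals\<close>

text \<open>On the model the log-likelihood is the scalar product of \<open>d\<close> with a vector
  of the row span, so \<open>d\<close> may be replaced there by \<open>p\<close>, which has the same
  marginals. Gibbs' inequality then makes \<open>p\<close> strictly better than any other
  member.\<close>

lemma is_MLE_iff_matching_marginals:
  assumes parts: "\<forall>M\<in>set Ms. partition_matrix m M"
    and d: "d \<in> open_simplex m" and p: "p \<in> model (stack m Ms)"
    and match: "\<And>M i. M \<in> set Ms \<Longrightarrow> i < dim_row M \<Longrightarrow> row M i \<bullet> p = row M i \<bullet> d"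
  shows "is_MLE (stack m Ms) d q \<longleftrightarrow> q = p"
proof -
  have model_simplex: "q \<in> carrier_vec m" "\<forall>j<m. 0 < q $ j" "(\<Sum>j<m. q $ j) = 1"
    if "q \<in> model (stack m Ms)" for q
    using that by (auto simp: model_def open_simplex_def)
  note p_simplex = model_simplex[OF p]
  have dc: "d \<in> carrier_vec m" using d by (simp add: open_simplex_def)
  have lik: "likelihood d q = exp (\<Sum>j<m. p $ j * ln (q $ j))" if q: "q \<in> model (stack m Ms)" for q
  proof -
    note qc = model_simplex(1)[OF q] and q_pos = model_simplex(2)[OF q]
    have "likelihood d q = (\<Prod>j<m. exp (d $ j * ln (q $ j)))"
      unfolding likelihood_def carrier_vecD[OF dc]
    proof (rule prod.cong[OF refl])
      fix j assume "j \<in> {..<m}"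
      \<comment> \<open>Needed because \<open>powr\<close> takes the value 0 at base 0 instead of
        following the exponential formula.\<close>
      then have "q $ j \<noteq> 0" using q_pos by fastforce
      then show "q $ j powr d $ j = exp (d $ j * ln (q $ j))" by (simp add: powr_def)
    qed
    also have "\<dots> = exp (\<Sum>j<m. d $ j * ln (q $ j))"
      by (simp add: exp_sum)
    also have "(\<Sum>j<m. d $ j * ln (q $ j)) = map_vec ln q \<bullet> d"
      unfolding scalar_prod_lessThan[OF dc] using carrier_vecD[OF qc]
      by (intro sum.cong) simp_all
    also have "\<dots> = map_vec ln q \<bullet> p"
      by (rule rowspan_stack_scalar_prod_eq[OF parts _ dc p_simplex(1) match[symmetric]])
        (use q in \<open>simp_all add: model_def\<close>)
    also have "\<dots> = (\<Sum>j<m. p $ j * ln (q $ j))"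
      unfolding scalar_prod_lessThan[OF p_simplex(1)] using carrier_vecD[OF qc]
      by (intro sum.cong) simp_all
    finally show ?thesis .
  qed
  have less: "likelihood d q < likelihood d p" if q: "q \<in> model (stack m Ms)" "q \<noteq> p" for q
  proof -
    obtain k where "k < m" "p $ k \<noteq> q $ k"
      using model_simplex(1)[OF q(1)] p_simplex(1) q(2) by (metis carrier_vecD eq_vecI)
    then show ?thesis
      using sum_mult_ln_less[of "{..<m}" "($) p" "($) q" k] model_simplex[OF q(1)] p_simplex
      by (simp add: lik[OF q(1)] lik[OF p])
  qed
  show ?thesis
    using less p unfolding is_MLE_def is_arg_max_def by (metis less_asym)
qed

section \<open>The first cycle of IPS\<close>

context
  fixes m :: nat and As :: "real mat list" and d :: "real vec"
  assumes multi: "multipartition m As" and d: "d \<in> open_simplex m"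
begin

lemma partition_nth: "l < length As \<Longrightarrow> partition_matrix m (As ! l)"
  and parts: "\<forall>M\<in>set As. partition_matrix m M"
  and parts_take: "\<forall>M\<in>set (take l As). partition_matrix m M"
  using multi by (auto simp: multipartition_def dest: in_set_takeD)

lemma d_carrier: "d \<in> carrier_vec m" and d_pos: "j < m \<Longrightarrow> 0 < d $ j"
  using d by (auto simp: open_simplex_def)

lemma IPS_carrier [simp]: "IPS m As d l \<in> carrier_vec m"
  by (cases l) (auto simp: Let_def)

lemma dim_vec_IPS [simp]: "dim_vec (IPS m As d l) = m"
  by (rule carrier_vecD[OF IPS_carrier])

text \<open>During the first cycle \<open>l mod length As\<close> is just \<open>l\<close>, and both
  scalar products are sums over the columns that share the row of \<open>j\<close>.\<close>

lemma IPS_Suc_index: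
  assumes "l < length As" "j < m"
  shows "IPS m As d (Suc l) $ j = IPS m As d l $ j *
    ((\<Sum>i | i < m \<and> row_containing (As ! l) i = row_containing (As ! l) j. d $ i) /
     (\<Sum>i | i < m \<and> row_containing (As ! l) i = row_containing (As ! l) j. IPS m As d l $ i))"
  using assms row_containing_less[OF partition_nth[OF assms(1)] assms(2)]
  by (simp add: Let_def d_carrier row_partition_scalar_prod[OF partition_nth[OF assms(1)]])

lemma class_sum_pos:
  fixes f :: "nat \<Rightarrow> real"
  assumes "j < m" "\<And>i. i < m \<Longrightarrow> 0 < f i"
  shows "0 < (\<Sum>i | i < m \<and> x i = x j. f i)"
  using assms by (intro sum_pos) auto

lemma IPS_pos: "l \<le> length As \<Longrightarrow> j < m \<Longrightarrow> 0 < IPS m As d l $ j"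
proof (induction l arbitrary: j)
  case (Suc l)
  then show ?case
    by (auto simp del: IPS.simps simp: IPS_Suc_index d_pos intro!: mult_pos_pos divide_pos_pos class_sum_pos)
qed simp

text \<open>The start is uniform, and the factor of each step depends on a column only through its
  row in the partition used.\<close>

lemma IPS_cong:
  assumes "l \<le> length As" "i < m" "j < m"
    and "\<forall>M\<in>set (take l As). row_containing M i = row_containing M j"
  shows "IPS m As d l $ i = IPS m As d l $ j"
  using assms
proof (induction l)
  case (Suc l)
  then have "IPS m As d l $ i = IPS m As d l $ j"
    "row_containing (As ! l) i = row_containing (As ! l) j"
    by (simp_all add: take_Suc_conv_app_nth del: IPS.simps)
  then show ?case using Suc.prems by (simp del: IPS.simps add: IPS_Suc_index)
qed simp

text \<open>All columns of a row receive the same factor, whose denominator cancels against the old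
  row sum.\<close>

lemma IPS_Suc_matches:
  assumes "l < length As" "i < dim_row (As ! l)"
  shows "row (As ! l) i \<bullet> IPS m As d (Suc l) = row (As ! l) i \<bullet> d"
proof -
  let ?y = "row_containing (As ! l)" and ?p = "IPS m As d l"
  note M = partition_nth[OF assms(1)]
  obtain k where k: "k < m" "?y k = i"
    using supp_partition_matrix_nonempty[OF M assms(2)] by blast
  have pos: "0 < (\<Sum>j | j < m \<and> ?y j = i. ?p $ j)"
    using class_sum_pos[OF k(1), of "($) ?p" ?y] IPS_pos[of l] assms(1) k by simp
  have "row (As ! l) i \<bullet> IPS m As d (Suc l) = (\<Sum>j | j < m \<and> ?y j = i. IPS m As d (Suc l) $ j)"
    by (rule row_partition_scalar_prod[OF M assms(2) IPS_carrier])
  also have "\<dots> = (\<Sum>j | j < m \<and> ?y j = i. ?p $ j *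
      ((\<Sum>j | j < m \<and> ?y j = i. d $ j) / (\<Sum>j | j < m \<and> ?y j = i. ?p $ j)))"
    using assms(1) by (intro sum.cong) (auto simp: IPS_Suc_index simp del: IPS.simps)
  also have "\<dots> = (\<Sum>j | j < m \<and> ?y j = i. d $ j)"
    using pos unfolding sum_distrib_right[symmetric] by simp
  also have "\<dots> = row (As ! l) i \<bullet> d"
    by (rule row_partition_scalar_prod[OF M assms(2) d_carrier, symmetric])
  finally show ?thesis .
qed

text \<open>An instance of \<open>class_sum_scaling\<close> with the rows of the Cup matrix as
  classes. The three clauses of the GRIP supply its hypotheses on proportions, florets and floret
  marginals, the last one through \<open>match\<close>.\<close>

lemma IPS_Suc_class_sums:
  assumes "GRIP m As" "1 \<le> l" "l < length As" "j < m"
    and match: "\<And>M i. M \<in> set (take l As) \<Longrightarrow> i < dim_row M \<Longrightarrow>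
      row M i \<bullet> IPS m As d l = row M i \<bullet> d"
  defines "X \<equiv> col (stack m (take l As))"
  shows "(\<Sum>i | i < m \<and> X i = X j. IPS m As d (Suc l) $ i) = (\<Sum>i | i < m \<and> X i = X j. IPS m As d l $ i)"
proof -
  let ?S = "stack m (take l As)" and ?C = "As ! l" and ?p = "IPS m As d l"
  let ?B = "Cup_matrix ?S"
  let ?x = "row_containing ?B" and ?y = "row_containing ?C"
  have B: "partition_matrix m ?B"
    using partition_Cup_matrix[of ?S] by simp
  note C = partition_nth[OF assms(3)]
  have wc: "well_connected m [?B, ?C]" and floret: "floret_condition ?B ?C"
    and cap: "set (rows (Cap_matrix ?B ?C)) \<subseteq> rowspan ?S"
    using assms(1-3) by (auto simp: GRIP_def Let_def)
  have x_iff: "?x i = ?x k \<longleftrightarrow> X i = X k" if "i < m" "k < m" for i k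
    using that row_containing_Cup_matrix_eq_iff[of i ?S k] by (simp add: X_def)
  note F = connected_rows_row_containing[OF B C, symmetric]
  have "(\<Sum>i | i \<in> {..<m} \<and> ?x i = ?x j.
            ?p $ i * ((\<Sum>k | k \<in> {..<m} \<and> ?y k = ?y i. d $ k) / (\<Sum>k | k \<in> {..<m} \<and> ?y k = ?y i. ?p $ k)))
      = (\<Sum>i | i \<in> {..<m} \<and> ?x i = ?x j. ?p $ i)"
  proof (rule class_sum_scaling)
    fix i k assume "i \<in> {..<m}" and "k \<in> {..<m}"
    then have i: "i < m" and k: "k < m" by simp_all
    show "?p $ i = ?p $ k" if "?x i = ?x k"
      using IPS_cong[of l i k] that i k assms(3)
      by (simp add: x_iff X_def col_stack_eq_iff[OF parts_take])
    show "real (card {h \<in> {..<m}. ?x h = ?x i \<and> ?y h = ?y i}) / real (card {h \<in> {..<m}. ?x h = ?x i})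
        = real (card {h \<in> {..<m}. ?x h = ?x k \<and> ?y h = ?y k}) / real (card {h \<in> {..<m}. ?x h = ?x k})"
      if "?y i = ?y k"
      by (rule well_connected_pair_ratio[OF B C wc i k that])
    show "?y ` {h \<in> {..<m}. ?x h = ?x i} \<inter> ?y ` {h \<in> {..<m}. ?x h = ?x k} = {} \<or>
        ?y ` {h \<in> {..<m}. ?x h = ?x i} = ?y ` {h \<in> {..<m}. ?x h = ?x k}"
      unfolding F[OF i] F[OF k]
      by (rule floret[unfolded floret_condition_def, rule_format,
            OF row_containing_less[OF B i] row_containing_less[OF B k]])
  next
    fix i assume "i \<in> {..<m}"
    then have i: "i < m" by simp
    let ?F = "connected_rows ?B ?C (?x i)"
    let ?v = "vec m (\<lambda>h. if ?y h \<in> ?F then 1 else 0) :: real vec"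
    \<comment> \<open>The floret indicator is a row of the Cap matrix, so the third clause of the
      GRIP puts it in the span of rows whose marginals already agree.\<close>
    have "?v \<in> rowspan ?S"
      using floret_indicator_in_rows_Cap_matrix[OF row_containing_less[OF B i], of ?C] cap
      by (auto simp: partition_matrix_dim_col[OF C])
    then have "?v \<bullet> ?p = ?v \<bullet> d"
      by (rule rowspan_stack_scalar_prod_eq[OF parts_take _ IPS_carrier d_carrier match])
    moreover have "?v \<bullet> w = (\<Sum>h | h < m \<and> ?y h \<in> ?F. w $ h)" if "w \<in> carrier_vec m" for w
    proof -
      have "?v \<bullet> w = (\<Sum>h<m. if ?y h \<in> ?F then w $ h else 0)"
        unfolding scalar_prod_lessThan[OF that] by (intro sum.cong) simp_all
      then show ?thesis by (simp add: sum.If_cases Int_def)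
    qed
    ultimately show "(\<Sum>h | h \<in> {..<m} \<and> ?y h \<in> ?y ` {h \<in> {..<m}. ?x h = ?x i}. ?p $ h) =
        (\<Sum>h | h \<in> {..<m} \<and> ?y h \<in> ?y ` {h \<in> {..<m}. ?x h = ?x i}. d $ h)"
      unfolding F[OF i] using d_carrier by simp
  qed (use assms(3,4) IPS_pos in simp_all)
  moreover have "{i. i < m \<and> ?x i = ?x j} = {i. i < m \<and> X i = X j}"
    using x_iff assms(4) by blast
  ultimately show ?thesis
    using assms(3) by (simp add: IPS_Suc_index del: IPS.simps)
qed

text \<open>By induction on the steps: a row of an earlier partition is constant on the classes, so
  preserved class sums preserve its marginal; the newest partition is fitted by the step
  itself.\<close>

lemma IPS_matches:
  assumes "GRIP m As" "l \<le> length As" "M \<in> set (take l As)" "i < dim_row M"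
  shows "row M i \<bullet> IPS m As d l = row M i \<bullet> d"
  using assms(2-4)
proof (induction l arbitrary: M i)
  case (Suc l)
  show ?case
  proof (cases "M \<in> set (take l As)")
    case True
    \<comment> \<open>As \<open>M\<close> occurs among the first \<open>l\<close> partitions,
      \<open>l\<close> is positive and the GRIP covers this step.\<close>
    then have l: "1 \<le> l" "l < length As" using Suc.prems by (cases l; simp)+
    have M: "partition_matrix m M" using parts_take True by blast
    have scalar: "row M i \<bullet> w = (\<Sum>j\<in>{..<m}. row M i $ j * w $ j)" if "w \<in> carrier_vec m" for w
      by (rule scalar_prod_lessThan[OF that])
    have "(\<Sum>j\<in>{..<m}. row M i $ j * IPS m As d (Suc l) $ j) = (\<Sum>j\<in>{..<m}. row M i $ j * IPS m As d l $ j)"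
    proof (rule sum_eq_if_fibre_sums_eq[where x = "col (stack m (take l As))"])
      fix j k assume jk: "j \<in> {..<m}" "k \<in> {..<m}"
        "col (stack m (take l As)) j = col (stack m (take l As)) k"
      then have "row_containing M j = row_containing M k"
        using True by (simp add: col_stack_eq_iff[OF parts_take])
      then show "row M i $ j = row M i $ k"
        using jk(1,2) partition_matrix_index[OF M _ Suc.prems(3)] Suc.prems(3)
          partition_matrix_dim_col[OF M]
        by simp
    qed (use IPS_Suc_class_sums[OF assms(1) l] Suc.IH l in \<open>simp_all del: IPS.simps\<close>)
    then have "row M i \<bullet> IPS m As d (Suc l) = row M i \<bullet> IPS m As d l"
      by (simp only: scalar IPS_carrier)
    then show ?thesis using Suc True by (simp del: IPS.simps)
  next
    case False
    then have "M = As ! l" using Suc.prems by (simp add: take_Suc_conv_app_nth)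
    then show ?thesis using Suc.prems IPS_Suc_matches by (simp del: IPS.simps)
  qed
qed simp

text \<open>The logarithm of the start is a constant vector, a combination of the rows of any one
  partition. Each step adds a vector that depends on a column only through its row in
  \<open>As ! l\<close>.\<close>

lemma ln_IPS_in_rowspan:
  "l \<le> length As \<Longrightarrow> map_vec ln (IPS m As d l) \<in> rowspan (stack m As)"
proof (induction l)
  case 0
  have "As ! 0 \<in> set As" using multi by (simp add: multipartition_def)
  moreover have "map_vec ln (IPS m As d 0) = vec m (\<lambda>_. ln (1 / real m))"
    by (intro eq_vecI) simp_all
  ultimately show ?case
    using vec_row_containing_in_rowspan[OF parts, of _ "\<lambda>_. ln (1 / real m)"] by simp
next
  case (Suc l)
  let ?y = "row_containing (As ! l)" and ?p = "IPS m As d l"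
  \<comment> \<open>The logarithm of the factor by which the step multiplies the entries of row
    \<open>u\<close>.\<close>
  define c where "c u = ln ((\<Sum>i | i < m \<and> ?y i = u. d $ i) / (\<Sum>i | i < m \<and> ?y i = u. ?p $ i))" for u
  have "map_vec ln (IPS m As d (Suc l)) = map_vec ln ?p + vec m (\<lambda>j. c (?y j))"
  proof (rule eq_vecI)
    fix j assume "j < dim_vec (map_vec ln ?p + vec m (\<lambda>j. c (?y j)))"
    then have j: "j < m" by simp
    have "0 < ?p $ j" "0 < (\<Sum>i | i < m \<and> ?y i = ?y j. d $ i)"
      "0 < (\<Sum>i | i < m \<and> ?y i = ?y j. ?p $ i)"
      using j Suc.prems by (auto intro!: class_sum_pos simp: IPS_pos d_pos)
    then show "map_vec ln (IPS m As d (Suc l)) $ j = (map_vec ln ?p + vec m (\<lambda>j. c (?y j))) $ j"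
      using j Suc.prems
      by (simp del: IPS.simps times_divide_eq_right add: IPS_Suc_index c_def ln_mult_pos)
  qed (simp del: IPS.simps)
  then show ?case
    using Suc rowspan_stack_add[OF parts]
      vec_row_containing_in_rowspan[OF parts, of "As ! l" c] by simp
qed

text \<open>Normalization is a consequence of the fitted marginals: the all-ones vector lies in the
  row span, so the result has the same total mass as \<open>d\<close>.\<close>

lemma IPS_in_model:
  assumes "GRIP m As"
  shows "IPS m As d (length As) \<in> model (stack m As)"
proof -
  let ?p = "IPS m As d (length As)"
  have "As ! 0 \<in> set As" using multi by (simp add: multipartition_def)
  from vec_row_containing_in_rowspan[OF parts this, of "\<lambda>_. 1"]
  have "vec m (\<lambda>_. 1) \<bullet> ?p = vec m (\<lambda>_. 1) \<bullet> d"
    by (rule rowspan_stack_scalar_prod_eq[OF parts _ IPS_carrier d_carrier])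
      (simp add: IPS_matches[OF assms])
  then have "(\<Sum>j<m. ?p $ j) = (\<Sum>j<m. d $ j)"
    by (simp add: scalar_prod_lessThan[OF d_carrier] scalar_prod_lessThan[OF IPS_carrier])
  then show ?thesis
    using d IPS_pos ln_IPS_in_rowspan by (simp add: model_def open_simplex_def)
qed

end

theorem theorem3p22:
  fixes m :: nat and As :: "real mat list"
  assumes "multipartition m As"
    and "GRIP m As"
  shows "\<forall>d \<in> open_simplex m. \<forall>p. is_MLE (stack m As) d p \<longleftrightarrow> p = IPS m As d (length As)"
proof (intro ballI allI)
  fix d p assume d: "d \<in> open_simplex m"
  show "is_MLE (stack m As) d p \<longleftrightarrow> p = IPS m As d (length As)"
    using parts[OF assms(1) d] d IPS_in_model[OF assms(1) d assms(2)]
      IPS_matches[OF assms(1) d assms(2), of "length As"]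
    by (intro is_MLE_iff_matching_marginals) auto
qed

end
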